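(* Given $\varepsilon>0$ and positive integers $h\ge 2$, $w\ge 1$ such that $\varepsilon w$ is also an integer, consider the poset $P=K_{\varepsilon w,w,w,\dots,w}$ (one antichain of size $\varepsilon w$ followed by $h-1$ antichains of size $w$) with $(\varepsilon+h-1)w$ elements. Then: (1) Every subposet obtained by the removal of less than $\varepsilon w^2$ edges from $P$ contains $C_h$ as a subposet; hence $P$ is at least $\frac{\varepsilon}{(\varepsilon+h-1)^2}$-far from being $C_h$-free. (2) For any $0<c<\varepsilon w$, the probability that a random subset of $P$ with at most $\frac{c}{2\varepsilon}$ elements does not contain $C_h$ as a subposet is at least $e^{-c}$.
   Context: A poset is a finite set with an anti-reflexive, transitive relation $\prec$; it is regarded as a digraph whose edges are the pairs $(x,y)$ with $x\prec y$. $|P|$ is the number of elements of $P$. $K_{w_1,w_2,\dots,w_k}$ is the complete $k$-partite poset: its set of elements is the union of pairwise disjoint antichains $A_1,\dots,A_k$ with $|A_i|=w_i$, and for $x\in A_i$, $y\in A_j$ one has $x\prec y$ if and only if $i<j$. $C_h$ is the chain with $h$ elements; a poset is $C_h$-free if it does not contain $C_h$ as a (not necessarily induced) subposet, i.e. contains no chain with $h$ elements. A subposet obtained by the removal of edges is a poset on the same set of elements whose edge set is obtained from that of $P$ by deleting those edges. $P$ is at least $\delta$-far from being $C_h$-free if every $C_h$-free poset on the same set of elements differs from $P$ in at least $\delta|P|^2$ edges. In (2), for any integer $k\le\frac{c}{2\varepsilon}$ the random subset is chosen uniformly among the $k$-element subsets of $P$.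
   Formalization: Part (1), including the farness claim, is stated only for ε ≤ 1 or h = 2; for ε > 1 and h ≥ 3 it is false, since deleting the w² < εw² edges between two antichains of size w leaves a C_h-free poset. *)

theory Defs
  imports "HOL-Probability.Probability_Mass_Function"
begin

record 'a digr =
  elems :: "'a set"
  edges :: "'a rel"

definition poset :: "'a digr \<Rightarrow> bool" where
  "poset P \<longleftrightarrow> finite (elems P) \<and> edges P \<subseteq> elems P \<times> elems P \<and> irrefl (edges P) \<and> trans (edges P)"

text \<open>Containment of a copy of \<open>Q\<close> in \<open>P\<close>, not necessarily an induced one.\<close>

definition contains_subposet :: "'a digr \<Rightarrow> 'b digr \<Rightarrow> bool" where
  "contains_subposet P Q \<longleftrightarrow>
     (\<exists>f. inj_on f (elems Q) \<and> f ` elems Q \<subseteq> elems P \<and>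
          (\<forall>(x, y) \<in> edges Q. (f x, f y) \<in> edges P))"

definition chain_poset :: "nat \<Rightarrow> nat digr" where
  "chain_poset h = \<lparr>elems = {..<h}, edges = {(i, j). i < j \<and> j < h}\<rparr>"

definition induced :: "'a digr \<Rightarrow> 'a set \<Rightarrow> 'a digr" where
  "induced P S = \<lparr>elems = elems P \<inter> S, edges = Restr (edges P) S\<rparr>"

text \<open>The pair \<open>(i, a)\<close> is the \<open>a\<close>-th element of the \<open>i\<close>-th antichain, both counted from 0.\<close>

definition complete_multipartite :: "nat list \<Rightarrow> (nat \<times> nat) digr" where
  "complete_multipartite ws =
     (let V = {(i, a). i < length ws \<and> a < ws ! i}
      in \<lparr>elems = V, edges = {(x, y). x \<in> V \<and> y \<in> V \<and> fst x < fst y}\<rparr>)"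

text \<open>\<open>Q\<close> arises from \<open>P\<close> by removing edges; the result must again be a poset.\<close>

definition edge_removal :: "'a digr \<Rightarrow> 'a digr \<Rightarrow> bool" where
  "edge_removal P Q \<longleftrightarrow> poset Q \<and> elems Q = elems P \<and> edges Q \<subseteq> edges P"

definition far_from_chain_free :: "real \<Rightarrow> nat \<Rightarrow> 'a digr \<Rightarrow> bool" where
  "far_from_chain_free \<delta> h P \<longleftrightarrow>
     (\<forall>Q. poset Q \<and> elems Q = elems P \<and> \<not> contains_subposet Q (chain_poset h) \<longrightarrow>
          \<delta> * (real (card (elems P)))\<^sup>2
            \<le> real (card ((edges P - edges Q) \<union> (edges Q - edges P))))"

lemma poset_complete_multipartite: "poset (complete_multipartite ws)"
proof -
  have "{(i, a). i < length ws \<and> a < ws ! i} = (SIGMA i:{..<length ws}. {..<ws ! i})"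
    by auto
  then have "finite {(i, a). i < length ws \<and> a < ws ! i}"
    by simp
  then show ?thesis
    by (auto simp: poset_def complete_multipartite_def irrefl_def trans_def)
qed

end

theory Submission
  imports Defs "HOL-Number_Theory.Cong"
begin

text \<open>
  Every chain with \<open>h\<close> elements in \<open>P\<close> takes exactly one element from each of the \<open>h\<close> antichains,
  because the index of the antichain increases along the chain. The first part exhibits many such
  chains; the second makes them impossible by avoiding one antichain.

  For the first part, \<open>\<epsilon> w\<^sup>2 = m w\<close>, so it suffices to find \<open>m w\<close> chains such that an edge
  of \<open>P\<close> joins consecutive elements of at most one of them. Removing fewer than \<open>m w\<close> edges then
  leaves all consecutive pairs of some chain intact, and transitivity of the remaining poset
  restores its other pairs. The chains are indexed by \<open>a < m\<close> and \<open>b < w\<close>: the chain starts at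
  element \<open>a\<close> of the small antichain and then alternates between the elements \<open>b\<close> and
  \<open>(a + b) mod w\<close> of the others (lemma \<open>transversal_steps_determine\<close>). For \<open>m \<le> w\<close> every
  consecutive pair of elements determines \<open>a\<close> and \<open>b\<close>; for \<open>h = 2\<close> there is only the pair of \<open>a\<close>
  and \<open>b\<close> itself, and \<open>m\<close> may be arbitrary. Being far from \<open>C\<^sub>h\<close>-free follows, since the common
  edges of two posets on the same elements again form a poset, so edges added to \<open>P\<close> do not help
  to destroy chains.

  For the second part, a set that misses the antichain of size \<open>m\<close> meets only \<open>h - 1\<close> antichains
  and so contains no chain with \<open>h\<close> elements. With \<open>n = (h - 1) w\<close>, a random \<open>k\<close>-subset misses
  that antichain with probability \<open>(n choose k) / ((n + m) choose k)\<close>, a product of \<open>k\<close> factors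
  \<open>1 / (1 + m / (n - i))\<close>. As \<open>k < w / 2\<close>, each of them is at least \<open>exp (- 2 \<epsilon>)\<close>
  (lemma \<open>binomial_enlarge_le\<close>), and \<open>2 \<epsilon> k \<le> c\<close>.
\<close>

section \<open>Chains in posets\<close>

text \<open>
  Edges between consecutive elements suffice for a chain: transitivity supplies the other edges,
  and irreflexivity then makes the elements distinct.
\<close>

lemma contains_chain_if_consecutive:
  assumes Q: "poset Q"
    and mem: "\<And>i. i < h \<Longrightarrow> f i \<in> elems Q"
    and step: "\<And>i. Suc i < h \<Longrightarrow> (f i, f (Suc i)) \<in> edges Q"
  shows "contains_subposet Q (chain_poset h)"
proof -
  have tr: "trans (edges Q)" and ir: "irrefl (edges Q)"
    using Q by (auto simp: poset_def)
  have edge: "j < h \<Longrightarrow> (f i, f j) \<in> edges Q" if "i < j" for i j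
    using that
  proof (induction j)
    case 0
    then show ?case by simp
  next
    case (Suc j)
    show ?case
    proof (cases "i = j")
      case True
      then show ?thesis using step Suc.prems by blast
    next
      case False
      then have "(f i, f j) \<in> edges Q" using Suc by simp
      then show ?thesis using step[OF Suc.prems(1)] tr by (meson transD)
    qed
  qed
  have "inj_on f {..<h}"
  proof (rule linorder_inj_onI)
    fix i j assume "i < j" "j \<in> {..<h}"
    then show "f i \<noteq> f j" using edge[of i j] ir by (auto simp: irrefl_def)
  qed auto
  then show ?thesis
    unfolding contains_subposet_def chain_poset_def
    using mem edge by (intro exI[of _ f]) auto
qed

lemma poset_Int_edges:
  assumes "poset P" "poset Q" "elems Q = elems P"
  shows "edge_removal P \<lparr>elems = elems P, edges = edges P \<inter> edges Q\<rparr>"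
  using assms unfolding edge_removal_def poset_def
  by (auto simp: irrefl_def intro: trans_Int)

text \<open>
  The passage from removing edges to arbitrary changes: a \<open>C\<^sub>h\<close>-free poset \<open>Q\<close> can be replaced by
  its common part with \<open>P\<close>, which is still \<open>C\<^sub>h\<close>-free and arises from \<open>P\<close> by removals.
\<close>

lemma far_from_chain_free_if_removals:
  assumes P: "poset P"
    and removal: "\<And>Q. \<lbrakk>edge_removal P Q; \<not> contains_subposet Q (chain_poset h)\<rbrakk>
      \<Longrightarrow> \<delta> * (real (card (elems P)))\<^sup>2 \<le> real (card (edges P - edges Q))"
  shows "far_from_chain_free \<delta> h P"
  unfolding far_from_chain_free_def
proof (intro allI impI, elim conjE)
  fix Q :: "'a digr"
  assume Q: "poset Q" "elems Q = elems P" and free: "\<not> contains_subposet Q (chain_poset h)"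
  define R where "R = \<lparr>elems = elems P, edges = edges P \<inter> edges Q\<rparr>"
  have "\<not> contains_subposet R (chain_poset h)"
    using free Q(2) unfolding contains_subposet_def R_def by fastforce
  moreover have "edge_removal P R"
    unfolding R_def by (rule poset_Int_edges[OF P Q])
  ultimately have le: "\<delta> * (real (card (elems P)))\<^sup>2 \<le> real (card (edges P - edges R))"
    by (rule removal[rotated])
  have fin: "finite (edges P)" "finite (edges Q)"
    using P Q by (auto simp: poset_def intro: finite_subset)
  have "edges P - edges R = edges P - edges Q"
    by (auto simp: R_def)
  then have "card (edges P - edges R) \<le> card ((edges P - edges Q) \<union> (edges Q - edges P))"
    using fin by (auto intro: card_mono)
  with le show "\<delta> * (real (card (elems P)))\<^sup>2
      \<le> real (card ((edges P - edges Q) \<union> (edges Q - edges P)))"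
    by linarith
qed

section \<open>Complete multipartite posets\<close>

lemma mem_elems_complete_multipartite:
  "(i, a) \<in> elems (complete_multipartite ws) \<longleftrightarrow> i < length ws \<and> a < ws ! i"
  by (simp add: complete_multipartite_def Let_def)

lemma mem_edges_complete_multipartite:
  "(x, y) \<in> edges (complete_multipartite ws) \<longleftrightarrow>
     x \<in> elems (complete_multipartite ws) \<and> y \<in> elems (complete_multipartite ws) \<and> fst x < fst y"
  by (simp add: complete_multipartite_def Let_def)

lemma card_complete_multipartite: "card (elems (complete_multipartite ws)) = sum_list ws"
proof -
  have "elems (complete_multipartite ws) = (SIGMA i:{..<length ws}. {..<ws ! i})"
    by (auto simp: complete_multipartite_def Let_def)
  then show ?thesis
    by (simp add: sum_list_sum_nth atLeast0LessThan)
qed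

lemma card_first_antichain:
  "card (elems (complete_multipartite (m # ws)) \<inter> {x. fst x = 0}) = m"
proof -
  have "elems (complete_multipartite (m # ws)) \<inter> {x. fst x = 0} = Pair 0 ` {..<m}"
    by (auto simp: mem_elems_complete_multipartite)
  then show ?thesis
    by (simp add: card_image inj_on_def)
qed

text \<open>
  The antichain index increases along a chain, hence is injective on it; if the antichain with
  index \<open>0\<close> is missed, only \<open>length ws\<close> indices remain.
\<close>

lemma no_long_chain_if_first_missed:
  assumes miss: "S \<inter> {x. fst x = 0} = {}"
  shows "\<not> contains_subposet (induced (complete_multipartite (m # ws)) S)
    (chain_poset (Suc (length ws)))"
proof
  let ?P = "complete_multipartite (m # ws)" and ?h = "Suc (length ws)"
  assume "contains_subposet (induced ?P S) (chain_poset ?h)"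
  then obtain f where mem: "f ` {..<?h} \<subseteq> elems ?P \<inter> S"
    and edge: "\<And>i j. i < j \<Longrightarrow> j < ?h \<Longrightarrow> (f i, f j) \<in> edges ?P"
    unfolding contains_subposet_def induced_def chain_poset_def by auto
  have "inj_on (fst \<circ> f) {..<?h}"
  proof (rule linorder_inj_onI)
    fix i j assume "i < j" "j \<in> {..<?h}"
    then have "(f i, f j) \<in> edges ?P"
      using edge by simp
    then show "(fst \<circ> f) i \<noteq> (fst \<circ> f) j"
      by (simp add: mem_edges_complete_multipartite)
  qed auto
  then have "card ((fst \<circ> f) ` {..<?h}) = ?h"
    by (subst card_image) simp_all
  moreover have "(fst \<circ> f) ` {..<?h} \<subseteq> {1..<?h}"
  proof
    fix l assume "l \<in> (fst \<circ> f) ` {..<?h}"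
    then obtain i where i: "i < ?h" "l = fst (f i)" by auto
    then have "f i \<in> elems ?P" "f i \<in> S" using mem by auto
    then have "l < ?h" "l \<noteq> 0"
      using i miss mem_elems_complete_multipartite[of "fst (f i)" "snd (f i)" "m # ws"] by auto
    then show "l \<in> {1..<?h}" by simp
  qed
  then have "card ((fst \<circ> f) ` {..<?h}) \<le> card {1..<?h}"
    by (rule card_mono[rotated]) simp
  ultimately show False by simp
qed

section \<open>A family of chains with disjoint steps\<close>

text \<open>
  The \<open>i\<close>-th element of the chain with index \<open>(a, b)\<close>, as a position in the \<open>i\<close>-th antichain.
  The alternation lets any two consecutive positions determine \<open>b\<close> and \<open>(a + b) mod w\<close>.
\<close>

definition transversal :: "nat \<Rightarrow> nat \<times> nat \<Rightarrow> nat \<Rightarrow> nat \<times> nat" where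
  "transversal w ab i =
     (i, if i = 0 then fst ab else if odd i then snd ab else (fst ab + snd ab) mod w)"

text \<open>
  A step from the first antichain shows \<open>a\<close> and \<open>b\<close> outright. A later step shows \<open>b\<close> and
  \<open>(a + b) mod w\<close>, hence \<open>a\<close> modulo \<open>w\<close>, and \<open>a\<close> is a residue when \<open>m \<le> w\<close>.
\<close>

lemma transversal_steps_determine:
  assumes mem: "ab \<in> {..<m} \<times> {..<w}" "ab' \<in> {..<m} \<times> {..<w}"
    and size: "m \<le> w \<or> i = 0"
    and eq: "transversal w ab i = transversal w ab' i'"
      "transversal w ab (Suc i) = transversal w ab' (Suc i')"
  shows "ab = ab'"
proof -
  obtain a b a' b' where ab: "ab = (a, b)" "ab' = (a', b')"
    by fastforce
  have i: "i' = i"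
    using eq(1) by (simp add: transversal_def)
  show ?thesis
  proof (cases "i = 0")
    case True
    then show ?thesis
      using eq unfolding i ab transversal_def by simp
  next
    case False
    then have b: "b = b'" and "(a + b) mod w = (a' + b') mod w"
      using eq unfolding i ab transversal_def by (auto split: if_splits)
    then have "[a + b = a' + b] (mod w)"
      by (simp add: cong_def)
    then have "[a = a'] (mod w)"
      by (simp add: cong_add_rcancel_nat)
    moreover have "a < w" "a' < w"
      using mem size False by (auto simp: ab)
    ultimately show ?thesis
      using b by (simp add: ab cong_def)
  qed
qed

lemma transversal_mem:
  assumes "ab \<in> {..<m} \<times> {..<w}" "i < h" "h \<ge> 1"
  shows "transversal w ab i \<in> elems (complete_multipartite (m # replicate (h - 1) w))"
  using assms
  by (cases i) (auto simp: transversal_def mem_elems_complete_multipartite)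

text \<open>
  If no chain survives, each of the \<open>m * w\<close> chains of the family has lost a step, and these
  lost edges are distinct.
\<close>

lemma removals_destroying_chains:
  assumes h: "h \<ge> 2" and size: "m \<le> w \<or> h = 2"
    and P: "P = complete_multipartite (m # replicate (h - 1) w)"
    and removal: "edge_removal P Q"
    and free: "\<not> contains_subposet Q (chain_poset h)"
  shows "m * w \<le> card (edges P - edges Q)"
proof -
  let ?I = "{..<m} \<times> {..<w}"
  have Q: "poset Q" "elems Q = elems P"
    using removal by (auto simp: edge_removal_def)
  have "finite (edges P)"
    using poset_complete_multipartite[of "m # replicate (h - 1) w"]
    unfolding poset_def P by (auto intro: finite_subset)
  then have fin: "finite (edges P - edges Q)"
    by simp
  have mem: "transversal w ab i \<in> elems P" if "ab \<in> ?I" "i < h" for ab i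
    using transversal_mem[OF that] h by (simp add: P)
  have "\<exists>i. Suc i < h \<and> (transversal w ab i, transversal w ab (Suc i)) \<notin> edges Q"
    if "ab \<in> ?I" for ab
    using contains_chain_if_consecutive[OF Q(1), of h "transversal w ab"] free mem[OF that] Q(2)
    by auto
  then obtain lost where lost: "\<And>ab. ab \<in> ?I \<Longrightarrow> Suc (lost ab) < h"
    "\<And>ab. ab \<in> ?I \<Longrightarrow>
      (transversal w ab (lost ab), transversal w ab (Suc (lost ab))) \<notin> edges Q"
    by metis
  define g where "g ab = (transversal w ab (lost ab), transversal w ab (Suc (lost ab)))" for ab
  have "g ab \<in> edges P - edges Q" if "ab \<in> ?I" for ab
  proof -
    have "fst (transversal w ab (lost ab)) < fst (transversal w ab (Suc (lost ab)))"
      by (simp add: transversal_def)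
    then have "g ab \<in> edges P"
      using mem[OF that] lost(1)[OF that]
      unfolding g_def P mem_edges_complete_multipartite by simp
    then show ?thesis
      using lost(2)[OF that] by (simp add: g_def)
  qed
  moreover have "inj_on g ?I"
  proof (rule inj_onI)
    fix ab ab' assume I: "ab \<in> ?I" "ab' \<in> ?I" and eq: "g ab = g ab'"
    have "m \<le> w \<or> lost ab = 0"
      using size lost(1)[OF I(1)] by auto
    then show "ab = ab'"
      using transversal_steps_determine[OF I, of "lost ab" "lost ab'"] eq by (simp add: g_def)
  qed
  ultimately have "card ?I \<le> card (edges P - edges Q)"
    using fin by (intro card_inj_on_le[of g]) auto
  then show ?thesis by simp
qed

section \<open>Random subsets\<close>

text \<open>
  Raising \<open>k\<close> by one multiplies the two binomial coefficients by \<open>n + m - k\<close> and \<open>n - k\<close>, up to a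
  common denominator, and \<open>n + m - k \<le> (1 + x) * (n - k) \<le> exp x * (n - k)\<close>.
\<close>

lemma binomial_enlarge_le:
  fixes x :: real
  assumes "k \<le> n" "x \<ge> 0" "real m \<le> x * real (Suc n - k)"
  shows "real ((n + m) choose k) \<le> exp (x * real k) * real (n choose k)"
  using assms
proof (induction k)
  case 0
  then show ?case by simp
next
  case (Suc k)
  have nk: "real (n - k) = real n - real k" "real (n + m - k) = real n + real m - real k"
    using Suc.prems by auto
  have m: "real m \<le> x * real (n - k)"
    using Suc.prems by simp
  also have "\<dots> \<le> x * real (Suc n - k)"
    using Suc.prems by (intro mult_left_mono) auto
  finally have IH: "real ((n + m) choose k) \<le> exp (x * real k) * real (n choose k)"
    using Suc by simp
  have "real (n + m - k) \<le> (1 + x) * real (n - k)"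
    using m nk by (simp add: algebra_simps)
  also have "\<dots> \<le> exp x * real (n - k)"
    by (intro mult_right_mono exp_ge_add_one_self) simp
  finally have factor: "real (n + m - k) \<le> exp x * real (n - k)" .
  have absorb: "real (Suc k) * real (N choose Suc k) = real (N choose k) * real (N - k)" for N
    using binomial_absorb_comp[of N k] binomial_absorption[of k N]
    by (metis mult.commute of_nat_mult)
  have "real (Suc k) * real ((n + m) choose Suc k) = real ((n + m) choose k) * real (n + m - k)"
    by (rule absorb)
  also have "\<dots> \<le> (exp (x * real k) * real (n choose k)) * (exp x * real (n - k))"
    using IH factor by (intro mult_mono) auto
  also have "\<dots> = exp (x * real (Suc k)) * (real (n choose k) * real (n - k))"
    by (simp add: algebra_simps exp_add)
  also have "\<dots> = real (Suc k) * (exp (x * real (Suc k)) * real (n choose Suc k))"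
    by (simp only: absorb[symmetric] mult_ac)
  finally show ?case
    by (simp only: mult_le_cancel_left_pos of_nat_0_less_iff zero_less_Suc)
qed

lemma prob_random_subset_misses:
  assumes V: "finite V" and k: "k \<le> card V"
  shows "measure_pmf.prob (pmf_of_set {S. S \<subseteq> V \<and> card S = k}) {S. S \<inter> A = {}}
    = real (card (V - A) choose k) / real (card V choose k)"
proof -
  let ?F = "{S. S \<subseteq> V \<and> card S = k}"
  have "card ?F > 0"
    using k V by (simp add: n_subsets)
  then have F: "?F \<noteq> {}" "finite ?F"
    using card_gt_0_iff by blast+
  have "?F \<inter> {S. S \<inter> A = {}} = {S. S \<subseteq> V - A \<and> card S = k}"
    by auto
  then show ?thesis
    using V by (simp add: measure_pmf_of_set[OF F] n_subsets)
qed

text \<open>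
  Since \<open>k \<le> n\<close> and \<open>2 * k \<le> w \<le> n\<close>, at least \<open>n - k \<ge> w / 2\<close> elements outside the first
  antichain remain available at each of the \<open>k\<close> choices, which allows the rate \<open>x = 2 \<epsilon>\<close> above.
\<close>

lemma prob_no_chain_ge:
  assumes h: "h \<ge> 2" and \<epsilon>: "\<epsilon> > 0" and m: "real m = \<epsilon> * real w" and k: "2 * k \<le> w"
    and P: "P = complete_multipartite (m # replicate (h - 1) w)"
  shows "exp (- (2 * \<epsilon> * real k)) \<le> measure_pmf.prob (pmf_of_set {S. S \<subseteq> elems P \<and> card S = k})
    {S. \<not> contains_subposet (induced P S) (chain_poset h)}"
proof -
  let ?A = "{x :: nat \<times> nat. fst x = 0}"
  define n where "n = (h - 1) * w"
  have "1 * w \<le> n"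
    unfolding n_def using h by (intro mult_right_mono) auto
  then have kn: "k \<le> n" and "real w \<le> 2 * real (Suc n - k)"
    using k by auto
  then have "\<epsilon> * real w \<le> \<epsilon> * (2 * real (Suc n - k))"
    using \<epsilon> by (intro mult_left_mono) auto
  then have "real m \<le> 2 * \<epsilon> * real (Suc n - k)"
    using m by (simp add: mult_ac)
  then have binom: "real ((n + m) choose k) \<le> exp (2 * \<epsilon> * real k) * real (n choose k)"
    using \<epsilon> kn by (intro binomial_enlarge_le) auto
  have fin: "finite (elems P)"
    using poset_complete_multipartite unfolding P poset_def by blast
  have card: "card (elems P) = n + m"
    unfolding P card_complete_multipartite by (simp add: sum_list_replicate n_def)
  have rest: "card (elems P - ?A) = n"
    using card_Diff_subset_Int[of "elems P" ?A] fin card card_first_antichain[of m]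
    by (simp add: P)
  have "real ((n + m) choose k) > 0"
    using kn by simp
  then have "exp (- (2 * \<epsilon> * real k)) \<le> real (n choose k) / real ((n + m) choose k)"
    using binom by (simp add: exp_minus field_simps)
  also have "\<dots> = measure_pmf.prob (pmf_of_set {S. S \<subseteq> elems P \<and> card S = k}) {S. S \<inter> ?A = {}}"
    using prob_random_subset_misses[OF fin, of k ?A] kn by (simp add: card rest)
  also have "\<dots> \<le> measure_pmf.prob (pmf_of_set {S. S \<subseteq> elems P \<and> card S = k})
      {S. \<not> contains_subposet (induced P S) (chain_poset h)}"
    using no_long_chain_if_first_missed[of _ m "replicate (h - 1) w"] h
    by (intro measure_pmf.finite_measure_mono) (auto simp: P)
  finally show ?thesis .
qed

section \<open>Distance from chain-freeness and random subsets\<close>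

theorem proposition2p4:
  fixes \<epsilon> :: real and h w m :: nat and P :: "(nat \<times> nat) digr"
  assumes "\<epsilon> > 0" and "h \<ge> 2" and "w \<ge> 1"
    and "real m = \<epsilon> * real w"
    and "P = complete_multipartite (m # replicate (h - 1) w)"
  shows "real (card (elems P)) = (\<epsilon> + real h - 1) * real w \<and>
         (\<epsilon> \<le> 1 \<or> h = 2 \<longrightarrow>
           (\<forall>Q. edge_removal P Q \<and> real (card (edges P - edges Q)) < \<epsilon> * (real w)\<^sup>2 \<longrightarrow>
                contains_subposet Q (chain_poset h)) \<and>
           far_from_chain_free (\<epsilon> / (\<epsilon> + real h - 1)\<^sup>2) h P) \<and>
         (\<forall>(c::real) (k::nat). 0 < c \<and> c < \<epsilon> * real w \<and> real k \<le> c / (2 * \<epsilon>) \<longrightarrow>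
           measure_pmf.prob (pmf_of_set {S. S \<subseteq> elems P \<and> card S = k})
             {S. \<not> contains_subposet (induced P S) (chain_poset h)} \<ge> exp (- c))"
proof (intro conjI impI)
  have "real (h - 1) = real h - 1"
    using assms(2) by (simp add: of_nat_diff)
  moreover have "card (elems P) = m + (h - 1) * w"
    unfolding assms(5) card_complete_multipartite by (simp add: sum_list_replicate)
  ultimately show card: "real (card (elems P)) = (\<epsilon> + real h - 1) * real w"
    using assms(4) by (simp only: of_nat_add of_nat_mult) (simp add: algebra_simps)
  have removed: "\<epsilon> * (real w)\<^sup>2 \<le> real (card (edges P - edges Q))"
    if "\<epsilon> \<le> 1 \<or> h = 2" "edge_removal P Q" "\<not> contains_subposet Q (chain_poset h)" for Q
  proof -
    have "real m \<le> 1 * real w" if "\<epsilon> \<le> 1"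
      unfolding assms(4) using that by (intro mult_right_mono) auto
    then have "m \<le> w \<or> h = 2"
      using \<open>\<epsilon> \<le> 1 \<or> h = 2\<close> by auto
    then have "m * w \<le> card (edges P - edges Q)"
      using removals_destroying_chains assms(2,5) that by blast
    then have "real m * real w \<le> real (card (edges P - edges Q))"
      by (metis of_nat_le_iff of_nat_mult)
    then show ?thesis
      by (simp add: assms(4) power2_eq_square mult_ac)
  qed
  assume small: "\<epsilon> \<le> 1 \<or> h = 2"
  show "\<forall>Q. edge_removal P Q \<and> real (card (edges P - edges Q)) < \<epsilon> * (real w)\<^sup>2 \<longrightarrow>
      contains_subposet Q (chain_poset h)"
    using removed[OF small] by force
  have "\<epsilon> + real h - 1 > 0"
    using assms(1,2) by simp
  then have "\<epsilon> / (\<epsilon> + real h - 1)\<^sup>2 * (real (card (elems P)))\<^sup>2 = \<epsilon> * (real w)\<^sup>2"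
    unfolding card by (simp add: power_mult_distrib)
  then show "far_from_chain_free (\<epsilon> / (\<epsilon> + real h - 1)\<^sup>2) h P"
    using removed[OF small] poset_complete_multipartite
    by (intro far_from_chain_free_if_removals) (auto simp: assms(5))
next
  show "\<forall>(c::real) (k::nat). 0 < c \<and> c < \<epsilon> * real w \<and> real k \<le> c / (2 * \<epsilon>) \<longrightarrow>
      measure_pmf.prob (pmf_of_set {S. S \<subseteq> elems P \<and> card S = k})
        {S. \<not> contains_subposet (induced P S) (chain_poset h)} \<ge> exp (- c)"
  proof (intro allI impI, elim conjE)
    fix c :: real and k :: nat
    assume c: "c < \<epsilon> * real w" and "real k \<le> c / (2 * \<epsilon>)"
    then have kc: "2 * \<epsilon> * real k \<le> c"
      using assms(1) by (simp add: field_simps)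
    with c have "\<epsilon> * (2 * real k) < \<epsilon> * real w"
      by (simp add: mult_ac)
    then have "2 * k \<le> w"
      using assms(1) by simp
    then have "exp (- (2 * \<epsilon> * real k)) \<le>
        measure_pmf.prob (pmf_of_set {S. S \<subseteq> elems P \<and> card S = k})
          {S. \<not> contains_subposet (induced P S) (chain_poset h)}"
      using prob_no_chain_ge assms by blast
    then show "exp (- c) \<le> measure_pmf.prob (pmf_of_set {S. S \<subseteq> elems P \<and> card S = k})
        {S. \<not> contains_subposet (induced P S) (chain_poset h)}"
      using kc by (meson order_trans exp_le_cancel_iff neg_le_iff_le)
  qed
qed

end
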